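(* Let $G$ be an abelian group and let $p$ be the smallest order of a non-zero element of $G$ (with $1/p$ read as $0$ if all non-zero elements have infinite order). Then for any finite, non-empty subset $A\subseteq G$ and any real $\gamma\in(0,1]$, $$\dim_I(P_\gamma(A))\le \big(2(1-1/p)\big)^{-1}\gamma^{-1}\log_2|A|.$$ Moreover, if $\exp(G)=3$, then $$\dim_I(P_\gamma(A))\le \gamma^{-1}\log_3|A|.$$
   Context: For a finite subset $P$ of an abelian group, $\dim_I(P)$ is the largest size of an independent subset of $P$, where a finite set $S$ is independent if for every integer-valued function $k$ on $S$, $\sum_{s\in S}k(s)s\ne0$ unless all summands $k(s)s$ are $0$. For $g\in G$, $r_A(g):=|\{(a,a')\in A\times A: g=a-a'\}|$, and $P_\gamma(A):=\{g\in G: r_A(g)\ge\gamma|A|\}$ is the set of $\gamma$-popular differences.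
   Formalization: Independent sets are required to consist of non-zero elements; if 0 were allowed, {0} would be independent and the bound would fail, e.g. for A={a}, where P_γ(A)={0} has dim_I 1 but log|A|=0. *)

theory Defs
  imports Complex_Main "HOL-Algebra.Algebra"
begin

text \<open>
  Abelian groups are the commutative groups of HOL-Algebra, hence written multiplicatively:
  \<^term>\<open>\<one>\<^bsub>G\<^esub>\<close> is the zero element, \<^term>\<open>s [^]\<^bsub>G\<^esub> (k::int)\<close> the multiple \<open>k s\<close>,
  \<open>a \<otimes> inv b\<close> the difference \<open>a - b\<close>, and \<^const>\<open>finprod\<close> the finite sum.
\<close>

text \<open>
  As usual for independence in abelian groups, the members of an independent set are non-zero.
  (If zero were admitted, it could be added to any independent set without affecting the
  condition on the sums.)
\<close>

definition independent_set :: "('a, 'b) monoid_scheme \<Rightarrow> 'a set \<Rightarrow> bool" where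
  "independent_set G S \<longleftrightarrow>
     finite S \<and> S \<subseteq> carrier G - {\<one>\<^bsub>G\<^esub>} \<and>
     (\<forall>k :: 'a \<Rightarrow> int. (\<Otimes>\<^bsub>G\<^esub>s\<in>S. s [^]\<^bsub>G\<^esub> k s) = \<one>\<^bsub>G\<^esub> \<longrightarrow>
        (\<forall>s\<in>S. s [^]\<^bsub>G\<^esub> k s = \<one>\<^bsub>G\<^esub>))"

text \<open>Meaningful for finite \<open>P\<close> only; the empty set is always independent.\<close>

definition dim_I :: "('a, 'b) monoid_scheme \<Rightarrow> 'a set \<Rightarrow> nat" where
  "dim_I G P = Max {card S |S. S \<subseteq> P \<and> independent_set G S}"

definition diff_count :: "('a, 'b) monoid_scheme \<Rightarrow> 'a set \<Rightarrow> 'a \<Rightarrow> nat" where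
  "diff_count G A g = card {(a, a') \<in> A \<times> A. g = a \<otimes>\<^bsub>G\<^esub> inv\<^bsub>G\<^esub> a'}"

definition popular_differences :: "('a, 'b) monoid_scheme \<Rightarrow> real \<Rightarrow> 'a set \<Rightarrow> 'a set" where
  "popular_differences G \<gamma> A =
     {g \<in> carrier G. real (diff_count G A g) \<ge> \<gamma> * real (card A)}"

text \<open>
  \<^const>\<open>group.ord\<close> is \<open>0\<close> on elements of infinite order. The value \<open>0\<close> below means that
  all non-zero elements have infinite order (vacuously so in the trivial group); since
  \<open>1 / 0 = 0\<close> in \<^typ>\<open>real\<close>, the reciprocal of the smallest order is then \<open>0\<close>.
\<close>

definition smallest_order :: "('a, 'b) monoid_scheme \<Rightarrow> nat" where
  "smallest_order G =
     (if \<exists>g \<in> carrier G - {\<one>\<^bsub>G\<^esub>}. group.ord G g \<noteq> 0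
      then LEAST n. n \<noteq> 0 \<and> (\<exists>g \<in> carrier G - {\<one>\<^bsub>G\<^esub>}. group.ord G g = n)
      else 0)"

text \<open>The least positive \<open>n\<close> annihilating the group; \<open>0\<close> if there is none.\<close>

definition group_exponent :: "('a, 'b) monoid_scheme \<Rightarrow> nat" where
  "group_exponent G =
     (if \<exists>n::nat. n > 0 \<and> (\<forall>g \<in> carrier G. g [^]\<^bsub>G\<^esub> n = \<one>\<^bsub>G\<^esub>)
      then LEAST n::nat. n > 0 \<and> (\<forall>g \<in> carrier G. g [^]\<^bsub>G\<^esub> n = \<one>\<^bsub>G\<^esub>)
      else 0)"

end

theory Submission
  imports Defs
begin

text \<open>
  It suffices to bound \<open>c \<Sum>s\<in>S. r\<^sub>A s\<close> by \<open>|A| ln |A|\<close> for independent \<open>S\<close>, since each summand is at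
  least \<open>\<gamma> |A|\<close> when \<open>S\<close> consists of popular differences. Add the elements \<open>s\<close> of \<open>S\<close> one at a time and
  cut \<open>A\<close> into its pieces in the cosets of the subgroup \<open>K\<close> generated by the earlier ones. These act
  within the pieces. By independence \<open>s\<close> permutes the cosets in cycles of length \<open>ord s\<close> (or in
  infinite paths), and \<open>r\<^sub>A s\<close> is at most the sum, over the edges of these cycles, of the smaller
  of the two piece sizes. So everything reduces to comparing such edge sums with the entropy of
  weights on paths and cycles. On a path a factor \<open>2 ln 2\<close> is available, from
  \<open>F (a + b) \<ge> F a + F b + 2 ln 2 min a b\<close> for \<open>F t = t ln t\<close>. On a cycle of length \<open>k\<close>, dropping the
  lightest edge loses a factor \<open>1 - 1/k\<close>, and for \<open>k = 3\<close> the sharp factor is \<open>ln 3\<close>.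
\<close>

subsection \<open>Entropy inequalities for weights on paths and cycles\<close>

definition xlnx :: "real \<Rightarrow> real" where
  "xlnx t = t * ln t"

text \<open>For positive arguments this is \<open>x * ln (N / x)\<close>, the perspective of
  \<open>- t ln t\<close>: the share of a weight \<open>x\<close> in the entropy of weights with
  total \<open>N\<close>.\<close>

definition persp :: "real \<Rightarrow> real \<Rightarrow> real" where
  "persp x N = x * ln N - xlnx x"

lemma persp_0 [simp]: "persp 0 N = 0"
  by (simp add: persp_def xlnx_def)

lemma persp_self [simp]: "persp x x = 0"
  by (simp add: persp_def xlnx_def)

lemma persp_mult:
  assumes "0 < r" "0 \<le> x"
  shows "persp x (r * x) = x * ln r"
  using assms by (cases "x = 0") (simp_all add: persp_def xlnx_def ln_mult distrib_left)

lemma persp_mono: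
  assumes "0 \<le> x" "x \<le> N" "N \<le> M"
  shows "persp x N \<le> persp x M"
proof (cases "x = 0")
  case False
  then have "ln N \<le> ln M" using assms by simp
  then show ?thesis using assms by (simp add: persp_def mult_left_mono)
qed simp

text \<open>This is the log sum inequality.\<close>

lemma persp_superadditive:
  assumes "0 \<le> x" "x \<le> N" "0 \<le> y" "y \<le> M"
  shows "persp x N + persp y M \<le> persp (x + y) (N + M)"
proof (cases "x = 0 \<or> y = 0")
  case True
  then show ?thesis using assms persp_mono[of x N "N + M"] persp_mono[of y M "N + M"] by auto
next
  case False
  then have pos: "x > 0" "y > 0" "N > 0" "M > 0" using assms by auto
  define D where "D = ln (N + M) - ln (x + y)"
  define q where "q = (x + y) / (N + M)"
  have q: "q > 0" "ln q = - D" "q * N + q * M = x + y"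
    using pos by (simp_all add: q_def D_def ln_div flip: distrib_left add_divide_distrib)
  \<comment> \<open>The tangent to the logarithm at the common ratio \<open>1 / q\<close> gives a
    bound linear in \<open>u\<close> and \<open>K\<close>. Its corrections \<open>q * K - u\<close>
    cancel when added over the two pairs.\<close>
  have tangent: "persp u K \<le> u * D + q * K - u" if "u > 0" "K > 0" for u K
  proof -
    have "ln (q * (K / u)) \<le> q * (K / u) - 1"
      using that q(1) by (intro ln_le_minus_one) simp
    then have "u * (ln K - ln u - D) \<le> u * (q * (K / u) - 1)"
      using that q(1,2) by (intro mult_left_mono) (simp_all add: ln_mult ln_div)
    then show ?thesis
      using that by (simp add: persp_def xlnx_def right_diff_distrib)
  qed
  have "persp (x + y) (N + M) = x * D + y * D"
    by (simp add: persp_def xlnx_def D_def algebra_simps)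
  with tangent[of x N] tangent[of y M] pos q(3) show ?thesis by linarith
qed

text \<open>By symmetry let \<open>b \<le> a\<close> and write (a, b) = (a - b) (1, 0) + b (1, 1).
  By superadditivity of \<open>persp\<close> the second layer alone contributes
  \<open>b * ln 2\<close> to each of the two terms whose sum is
  \<open>xlnx (a + b) - xlnx a - xlnx b\<close>.\<close>

lemma xlnx_add_ge:
  assumes "0 \<le> a" "0 \<le> b"
  shows "xlnx a + xlnx b + 2 * ln 2 * min a b \<le> xlnx (a + b)"
proof -
  have ordered: "xlnx a + xlnx b + 2 * ln 2 * b \<le> xlnx (a + b)" if "0 \<le> b" "b \<le> a" for a b :: real
  proof -
    have "a - b + 2 * b = b + a" by simp
    then have "b * ln 2 \<le> persp a (b + a)" "b * ln 2 \<le> persp b (b + a)"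
      using persp_superadditive[of "a - b" "a - b" b "2 * b"]
        persp_superadditive[of 0 "a - b" b "2 * b"] that persp_mult[of 2 b] by simp_all
    moreover have "persp a (a + b) + persp b (a + b) = xlnx (a + b) - xlnx a - xlnx b"
      by (simp add: persp_def xlnx_def[of "a + b"] distrib_right)
    moreover have "2 * ln 2 * b = 2 * (b * ln 2)" by simp
    ultimately show ?thesis by (simp only: add.commute[of b a])
  qed
  show ?thesis
    using ordered[of b a] ordered[of a b] assms by (cases "b \<le> a") (auto simp: add.commute min_def)
qed

text \<open>
  For \<open>a \<ge> b \<ge> c\<close> decompose
  \<open>(a, b, c) = (a - b) (1, 0, 0) + (b - c) (1, 1, 0) + c (1, 1, 1)\<close>: the edge sum is linear on this
  cone, and the entropy is superadditive.
\<close>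

lemma xlnx_add3_ge:
  assumes "0 \<le> a" "0 \<le> b" "0 \<le> c"
  shows "xlnx a + xlnx b + xlnx c + ln 3 * (min a b + min b c + min c a) \<le> xlnx (a + b + c)"
proof -
  have ordered: "xlnx a + xlnx b + xlnx c + ln 3 * (b + 2 * c) \<le> xlnx (a + b + c)"
    if "0 \<le> c" "c \<le> b" "b \<le> a" for a b c :: real
  proof -
    have two: "persp (b - c) (2 * (b - c)) = (b - c) * ln 2"
      using persp_mult[of 2 "b - c"] that by simp
    have three: "persp c (3 * c) = c * ln 3"
      using persp_mult[of 3 c] that by simp
    \<comment> \<open>The layer (1, 1, 1) has edge sum 3 and entropy 3 ln 3, which dictates the
      constant. The layer (1, 1, 0) has edge sum 1 and entropy 2 ln 2, so there ln 3 \<le> 2 ln 2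
      suffices.\<close>
    have "ln 3 \<le> ln (2 ^ 2 :: real)" by (subst ln_le_cancel_iff) auto
    then have "ln 3 \<le> 2 * ln (2 :: real)" by (simp only: ln_realpow)
    then have "(b - c) * ln 3 \<le> (b - c) * (2 * ln 2)"
      using that by (intro mult_left_mono) auto
    then have ln3: "b * ln 3 - c * ln 3 \<le> 2 * ((b - c) * ln 2)"
      by (simp only: left_diff_distrib) (simp add: algebra_simps)
    have N: "a - b + 2 * (b - c) + 3 * c = a + b + c" by simp
    have "persp (b - c) (2 * (b - c)) \<le> persp (a - b + (b - c)) (a - b + 2 * (b - c))"
      using persp_superadditive[of "a - b" "a - b" "b - c" "2 * (b - c)"] that by simp
    moreover have "persp (a - c) (a - b + 2 * (b - c)) + persp c (3 * c) \<le> persp (a - c + c) (a + b + c)"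
      unfolding N[symmetric] using that by (intro persp_superadditive) auto
    ultimately have A: "(b - c) * ln 2 + c * ln 3 \<le> persp a (a + b + c)"
      unfolding two three by simp
    have "persp (b - c) (2 * (b - c)) \<le> persp (b - c) (a - b + 2 * (b - c))"
      using that by (intro persp_mono) auto
    moreover have "persp (b - c) (a - b + 2 * (b - c)) + persp c (3 * c) \<le> persp (b - c + c) (a + b + c)"
      unfolding N[symmetric] using that by (intro persp_superadditive) auto
    ultimately have B: "(b - c) * ln 2 + c * ln 3 \<le> persp b (a + b + c)"
      unfolding two three by simp
    have C: "c * ln 3 \<le> persp c (a + b + c)"
      unfolding three[symmetric] using that by (intro persp_mono) auto
    have "persp a (a + b + c) + persp b (a + b + c) + persp c (a + b + c)
        = xlnx (a + b + c) - xlnx a - xlnx b - xlnx c"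
      by (simp add: persp_def xlnx_def[of "a + b + c"] distrib_right)
    moreover have "ln 3 * (b + 2 * c) = b * ln 3 + 2 * (c * ln 3)"
      by (simp add: distrib_left)
    ultimately show ?thesis using A B C ln3 by linarith
  qed
  \<comment> \<open>Every pair of vertices of a triangle is an edge, so the claim is symmetric and
    sorting the weights is harmless.\<close>
  consider "a \<ge> b" "b \<ge> c" | "a \<ge> c" "c \<ge> b" | "b \<ge> a" "a \<ge> c" | "b \<ge> c" "c \<ge> a"
    | "c \<ge> a" "a \<ge> b" | "c \<ge> b" "b \<ge> a" by linarith
  then show ?thesis
  proof cases
    case 1
    then show ?thesis using ordered[of c b a] assms by (simp add: add_ac)
  next
    case 2
    then show ?thesis using ordered[of b c a] assms by (simp add: add_ac)
  next
    case 3
    then show ?thesis using ordered[of c a b] assms by (simp add: add_ac)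
  next
    case 4
    then show ?thesis using ordered[of a c b] assms by (simp add: add_ac)
  next
    case 5
    then show ?thesis using ordered[of b a c] assms by (simp add: add_ac)
  next
    case 6
    then show ?thesis using ordered[of a b c] assms by (simp add: add_ac)
  qed
qed

section \<open>Entropy of weights on paths and cycles\<close>

lemma path_entropy:
  fixes f :: "nat \<Rightarrow> real"
  assumes "\<And>i. 0 \<le> f i"
  shows "2 * ln 2 * (\<Sum>i<m. min (f i) (f (Suc i))) \<le> xlnx (\<Sum>i<Suc m. f i) - (\<Sum>i<Suc m. xlnx (f i))"
proof (induction m)
  case (Suc m)
  \<comment> \<open>The edge to the new vertex is enlarged by replacing \<open>f m\<close> with the
    whole weight so far. Then \<open>xlnx_add_ge\<close> pays for it with exactly the entropy gained
    by merging the new vertex.\<close>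
  have "f m \<le> (\<Sum>i<Suc m. f i)" by (simp add: assms sum_nonneg)
  then have "min (f m) (f (Suc m)) \<le> min (\<Sum>i<Suc m. f i) (f (Suc m))" by (auto simp: min_def)
  then have "2 * ln 2 * min (f m) (f (Suc m)) \<le> 2 * ln 2 * min (\<Sum>i<Suc m. f i) (f (Suc m))"
    by (intro mult_left_mono) auto
  also have "\<dots> \<le> xlnx (\<Sum>i<Suc (Suc m). f i) - xlnx (\<Sum>i<Suc m. f i) - xlnx (f (Suc m))"
    using xlnx_add_ge[of "\<Sum>i<Suc m. f i" "f (Suc m)"] assms by (simp add: sum_nonneg)
  finally show ?case using Suc by (simp add: algebra_simps)
qed simp

text \<open>
  With \<open>N = (\<Sum>i<k. f i)\<close>, the right-hand side is \<open>N\<close> times the Shannon entropy (in nats) of the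
  distribution \<open>f / N\<close>.
\<close>

definition cycle_entropy :: "nat \<Rightarrow> real \<Rightarrow> bool" where
  "cycle_entropy k c \<longleftrightarrow> (\<forall>f :: nat \<Rightarrow> real. (\<forall>i. 0 \<le> f i) \<longrightarrow>
     c * (\<Sum>i<k. min (f i) (f (Suc i mod k))) \<le> xlnx (\<Sum>i<k. f i) - (\<Sum>i<k. xlnx (f i)))"

lemma cycle_entropy_mono:
  assumes "cycle_entropy k c'" "c \<le> c'"
  shows "cycle_entropy k c"
  unfolding cycle_entropy_def
proof (intro allI impI)
  fix f :: "nat \<Rightarrow> real" assume f: "\<forall>i. 0 \<le> f i"
  then have "c * (\<Sum>i<k. min (f i) (f (Suc i mod k))) \<le> c' * (\<Sum>i<k. min (f i) (f (Suc i mod k)))"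
    using assms(2) by (intro mult_right_mono sum_nonneg) auto
  then show "c * (\<Sum>i<k. min (f i) (f (Suc i mod k))) \<le> xlnx (\<Sum>i<k. f i) - (\<Sum>i<k. xlnx (f i))"
    using assms(1) f unfolding cycle_entropy_def by (meson order_trans)
qed

lemma cycle_entropy_3: "cycle_entropy 3 (ln 3)"
  unfolding cycle_entropy_def
proof (intro allI impI)
  have three: "{..<3} = {0, 1, 2 :: nat}" by auto
  fix f :: "nat \<Rightarrow> real" assume "\<forall>i. 0 \<le> f i"
  then show "ln 3 * (\<Sum>i<3. min (f i) (f (Suc i mod 3))) \<le> xlnx (\<Sum>i<3. f i) - (\<Sum>i<3. xlnx (f i))"
    unfolding three using xlnx_add3_ge[of "f 0" "f 1" "f 2"] by (simp add: numeral_2_eq_2 add.assoc)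
qed

lemma sum_rotate:
  fixes g :: "nat \<Rightarrow> real"
  shows "(\<Sum>i<k. g ((j + i) mod k)) = (\<Sum>i<k. g i)"
proof (cases "k = 0")
  case False
  have inj: "inj_on (\<lambda>i. (j + i) mod k) {..<k}"
  proof (rule linorder_inj_onI)
    fix a b assume "a < b" "a \<in> {..<k}" "b \<in> {..<k}"
    then have "\<not> k dvd (j + b) - (j + a)" by (auto dest: dvd_imp_le)
    with \<open>a < b\<close> show "(j + a) mod k \<noteq> (j + b) mod k"
      by (metis mod_eq_dvd_iff_nat add_left_mono less_imp_le)
  qed auto
  then have "(\<lambda>i. (j + i) mod k) ` {..<k} = {..<k}"
    using False by (intro endo_inj_surj) auto
  with inj have "bij_betw (\<lambda>i. (j + i) mod k) {..<k} {..<k}" by (simp add: bij_betw_def)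
  then show ?thesis by (rule sum.reindex_bij_betw)
qed simp

text \<open>Deleting the lightest edge turns the cycle into a path and costs at most \<open>1/k\<close> of the sum.\<close>

lemma cycle_entropy_general:
  assumes "k \<ge> 1"
  shows "cycle_entropy k (2 * (1 - 1 / real k) * ln 2)"
  unfolding cycle_entropy_def
proof (intro allI impI)
  fix f :: "nat \<Rightarrow> real" assume f: "\<forall>i. 0 \<le> f i"
  define g where "g i = min (f i) (f (Suc i mod k))" for i
  obtain m where k: "k = Suc m" using assms by (cases k) auto
  have "\<exists>j\<in>{..<k}. \<forall>i\<in>{..<k}. g j \<le> g i"
    using ex_min_if_finite[of "g ` {..<k}"] k by (fastforce simp: not_less)
  then obtain j where j: "j < k" "\<And>i. i < k \<Longrightarrow> g j \<le> g i" by auto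
  have "(\<Sum>i<k. g j) \<le> (\<Sum>i<k. g i)" by (intro sum_mono) (use j in auto)
  then have gj: "g j \<le> (\<Sum>i<k. g i) / real k" using k by (simp add: field_simps)
  \<comment> \<open>Reading the cycle from the vertex after the lightest edge \<open>j\<close> makes
    that edge the closing one, from \<open>h m\<close> to \<open>h k\<close>, so the path
    \<open>h 0, ..., h m\<close> has all the other edges.\<close>
  define h where "h i = f ((Suc j + i) mod k)" for i
  have gh: "g ((Suc j + i) mod k) = min (h i) (h (Suc i))" for i
    by (simp add: g_def h_def mod_Suc_eq)
  have "(\<Sum>i<k. g i) = (\<Sum>i<k. g ((Suc j + i) mod k))" by (simp only: sum_rotate)
  also have "\<dots> = (\<Sum>i<m. g ((Suc j + i) mod k)) + g ((Suc j + m) mod k)" by (simp add: k)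
  also have "(Suc j + m) mod k = (j + k) mod k" by (simp add: k)
  also have "\<dots> = j" using j(1) by simp
  finally have "(\<Sum>i<m. min (h i) (h (Suc i))) = (\<Sum>i<k. g i) - g j" by (simp only: gh)
  then have "(1 - 1 / real k) * (\<Sum>i<k. g i) \<le> (\<Sum>i<m. min (h i) (h (Suc i)))"
    using gj by (simp add: algebra_simps)
  then have "2 * ln 2 * ((1 - 1 / real k) * (\<Sum>i<k. g i)) \<le> 2 * ln 2 * (\<Sum>i<m. min (h i) (h (Suc i)))"
    by (intro mult_left_mono) auto
  also have "\<dots> \<le> xlnx (\<Sum>i<k. h i) - (\<Sum>i<k. xlnx (h i))"
    using path_entropy[of h m] f by (simp add: h_def k del: sum.lessThan_Suc)
  also have "\<dots> = xlnx (\<Sum>i<k. f i) - (\<Sum>i<k. xlnx (f i))"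
    unfolding h_def using sum_rotate[of f "Suc j" k] sum_rotate[of "\<lambda>i. xlnx (f i)" "Suc j" k] by simp
  also have "2 * ln 2 * ((1 - 1 / real k) * (\<Sum>i<k. g i)) = 2 * (1 - 1 / real k) * ln 2 * (\<Sum>i<k. g i)"
    by (simp only: mult_ac)
  finally show "2 * (1 - 1 / real k) * ln 2 * (\<Sum>i<k. min (f i) (f (Suc i mod k)))
      \<le> xlnx (\<Sum>i<k. f i) - (\<Sum>i<k. xlnx (f i))"
    unfolding g_def .
qed

lemma xlnx_superadditive:
  assumes "0 \<le> a" "0 \<le> b"
  shows "xlnx a + xlnx b \<le> xlnx (a + b)"
proof -
  have "0 \<le> 2 * ln 2 * min a b" using assms by simp
  with xlnx_add_ge[OF assms] show ?thesis by linarith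
qed

subsection \<open>Weights on the orbits of an injection\<close>

text \<open>Strong induction on \<open>U\<close>. A point whose image leaves \<open>U\<close> is the
  end of a path: removing it destroys at most one edge, paid for by \<open>xlnx_add_ge\<close>. If
  there is none, \<sigma> permutes \<open>U\<close>, and a whole cycle is split off and handled by
  \<open>cycle_entropy\<close> for its length.\<close>

lemma orbit_entropy:
  fixes n :: "'b \<Rightarrow> real" and \<sigma> :: "'b \<Rightarrow> 'b"
  assumes "finite U" "inj_on \<sigma> U" "\<And>x. 0 \<le> n x" "0 \<le> c" "c \<le> 2 * ln 2"
    and "\<And>x k. x \<in> U \<Longrightarrow> 0 < k \<Longrightarrow> (\<sigma> ^^ k) x = x \<Longrightarrow>
           (\<And>j. 0 < j \<Longrightarrow> j < k \<Longrightarrow> (\<sigma> ^^ j) x \<noteq> x) \<Longrightarrow> cycle_entropy k c"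
  shows "c * (\<Sum>x\<in>{x\<in>U. \<sigma> x \<in> U}. min (n x) (n (\<sigma> x))) \<le> xlnx (\<Sum>x\<in>U. n x) - (\<Sum>x\<in>U. xlnx (n x))"
  using assms(1,2,6)
proof (induction U rule: finite_psubset_induct)
  case (psubset U)
  note n = assms(3) and c = assms(4,5)
  define T where "T V = (\<Sum>x\<in>{x\<in>V. \<sigma> x \<in> V}. min (n x) (n (\<sigma> x)))" for V
  define E where "E V = xlnx (\<Sum>x\<in>V. n x) - (\<Sum>x\<in>V. xlnx (n x))" for V
  have IH: "c * T V \<le> E V" if "V \<subset> U" for V
    unfolding T_def E_def
    using that by (intro psubset.IH psubset.prems) (auto intro: inj_on_subset[OF psubset.prems(1)])
  have "c * T U \<le> E U"
  proof (cases "\<exists>x\<in>U. \<sigma> x \<notin> U")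
    case True
    then obtain x where x: "x \<in> U" "\<sigma> x \<notin> U" by auto
    let ?V = "U - {x}"
    have sumU: "sum h U = h x + sum h ?V" for h :: "'b \<Rightarrow> real"
      using psubset.hyps x by (simp add: sum.remove)
    \<comment> \<open>No edge leaves \<open>x\<close>, and by injectivity at most one enters it. The
      weight of its source is bounded by that of all remaining points.\<close>
    have "T U \<le> T ?V + min (n x) (sum n ?V)"
    proof (cases "\<exists>z\<in>U. \<sigma> z = x")
      case True
      then obtain z where z: "z \<in> U" "\<sigma> z = x" by auto
      have "z \<noteq> x" using x z by auto
      have "{y \<in> U. \<sigma> y \<in> U} = insert z {y \<in> ?V. \<sigma> y \<in> ?V}"
        using x z psubset.prems(1) by (auto simp: inj_on_def)
      moreover have "z \<notin> {y \<in> ?V. \<sigma> y \<in> ?V}" using z by auto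
      ultimately have "T U = min (n z) (n x) + T ?V"
        unfolding T_def using psubset.hyps z by simp
      moreover have "n z \<le> sum n ?V"
        using z \<open>z \<noteq> x\<close> psubset.hyps n by (intro member_le_sum) auto
      ultimately show ?thesis by (auto simp: min_def)
    next
      case False
      then have "{y \<in> U. \<sigma> y \<in> U} = {y \<in> ?V. \<sigma> y \<in> ?V}" using x by auto
      then have "T U = T ?V" unfolding T_def by simp
      then show ?thesis using n by (simp add: sum_nonneg)
    qed
    then have "c * T U \<le> c * T ?V + c * min (n x) (sum n ?V)"
      using c(1) by (metis distrib_left mult_left_mono)
    also have "c * min (n x) (sum n ?V) \<le> 2 * ln 2 * min (n x) (sum n ?V)"
      using c n by (intro mult_right_mono) (auto simp: sum_nonneg)
    also have "c * T ?V \<le> E ?V" using x by (intro IH) auto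
    also have "2 * ln 2 * min (n x) (sum n ?V) \<le> xlnx (sum n U) - xlnx (n x) - xlnx (sum n ?V)"
      using xlnx_add_ge[of "n x" "sum n ?V"] n by (simp add: sumU sum_nonneg)
    finally show ?thesis unfolding E_def by (simp add: sumU)
  next
    case False
    then have closed: "\<sigma> x \<in> U" if "x \<in> U" for x using that by auto
    show ?thesis
    proof (cases "U = {}")
      case True then show ?thesis by (simp add: T_def E_def xlnx_def)
    next
      case False
      then obtain x where x: "x \<in> U" by auto
      have orbit: "(\<sigma> ^^ i) x \<in> U" for i by (induction i) (auto simp: x closed)
      \<comment> \<open>Injectivity strips common initial iterates, so any collision on the orbit is
        a return to \<open>x\<close> itself: the orbit is a pure cycle without a tail.\<close>
      have cancel: "(\<sigma> ^^ (j - i)) x = x" if "i \<le> j" "(\<sigma> ^^ i) x = (\<sigma> ^^ j) x" for i j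
        using that
      proof (induction i arbitrary: j)
        case (Suc i)
        then obtain j' where "j = Suc j'" by (cases j) auto
        with Suc show ?case using psubset.prems(1) orbit by (auto simp: inj_on_def)
      qed simp
      have "\<not> inj (\<lambda>i. (\<sigma> ^^ i) x)"
      proof
        assume "inj (\<lambda>i. (\<sigma> ^^ i) x)"
        moreover have "range (\<lambda>i. (\<sigma> ^^ i) x) \<subseteq> U" using orbit by auto
        ultimately show False using psubset.hyps
          by (metis finite_subset finite_imageD infinite_UNIV_nat)
      qed
      then obtain i j where "i < j" "(\<sigma> ^^ i) x = (\<sigma> ^^ j) x"
        by (metis injI linorder_neqE_nat)
      then have ex: "0 < j - i \<and> (\<sigma> ^^ (j - i)) x = x" using cancel by auto
      define k where "k = (LEAST k. 0 < k \<and> (\<sigma> ^^ k) x = x)"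
      have k: "0 < k" "(\<sigma> ^^ k) x = x" using LeastI[of "\<lambda>k. 0 < k \<and> (\<sigma> ^^ k) x = x", OF ex]
        unfolding k_def by auto
      have least: "(\<sigma> ^^ j) x \<noteq> x" if "0 < j" "j < k" for j
        using that not_less_Least unfolding k_def by blast
      have cyc: "cycle_entropy k c" using x k least by (rule psubset.prems(2))
      have inj: "inj_on (\<lambda>i. (\<sigma> ^^ i) x) {..<k}"
      proof (rule linorder_inj_onI)
        fix i j assume "i < j" "i \<in> {..<k}" "j \<in> {..<k}"
        then show "(\<sigma> ^^ i) x \<noteq> (\<sigma> ^^ j) x"
          using cancel[of i j] least[of "j - i"] by auto
      qed auto
      define C where "C = (\<lambda>i. (\<sigma> ^^ i) x) ` {..<k}"
      have CU: "C \<subseteq> U" using orbit by (auto simp: C_def)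
      have step: "\<sigma> ((\<sigma> ^^ i) x) = (\<sigma> ^^ (Suc i mod k)) x" if "i < k" for i
        using that k by (cases "Suc i = k") auto
      have C_closed: "\<sigma> y \<in> C" if "y \<in> C" for y
        using that k step by (auto simp: C_def)
      have "inj_on \<sigma> C" using CU psubset.prems(1) inj_on_subset by blast
      then have image: "\<sigma> ` C = C" using C_closed by (intro endo_inj_surj) (auto simp: C_def)
      \<comment> \<open>Since \<sigma> already maps \<open>C\<close> onto itself, injectivity bars
        entry from outside. Hence no edge joins \<open>C\<close> to the rest, and the edge sum
        splits.\<close>
      have V_closed: "\<sigma> y \<notin> C" if "y \<in> U - C" for y
      proof
        assume "\<sigma> y \<in> C"
        then obtain z where "z \<in> C" "\<sigma> z = \<sigma> y" using image by (metis imageE)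
        then show False using that CU psubset.prems(1) by (auto dest: inj_onD)
      qed
      have sumC: "sum h C = (\<Sum>i<k. h ((\<sigma> ^^ i) x))" for h :: "'b \<Rightarrow> real"
        unfolding C_def by (simp add: sum.reindex[OF inj])
      have sumU: "sum h U = sum h C + sum h (U - C)" for h :: "'b \<Rightarrow> real"
        using sum.subset_diff[OF CU psubset.hyps] by (simp add: add.commute)
      have "c * T C \<le> E C"
      proof -
        have "T C = (\<Sum>y\<in>C. min (n y) (n (\<sigma> y)))"
          unfolding T_def using C_closed by (intro sum.cong) auto
        also have "\<dots> = (\<Sum>i<k. min (n ((\<sigma> ^^ i) x)) (n ((\<sigma> ^^ (Suc i mod k)) x)))"
          unfolding sumC using step by (intro sum.cong) auto
        finally show ?thesis
          using cyc[unfolded cycle_entropy_def, rule_format, of "\<lambda>i. n ((\<sigma> ^^ i) x)"] n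
          unfolding E_def sumC by simp
      qed
      moreover have "c * T (U - C) \<le> E (U - C)"
      proof (rule IH)
        have "x \<in> C" using k by (auto simp: C_def intro!: image_eqI[of _ _ 0])
        then show "U - C \<subset> U" using x by auto
      qed
      moreover have "T U = T C + T (U - C)"
      proof -
        have "{y\<in>U. \<sigma> y \<in> U} = U" "{y\<in>C. \<sigma> y \<in> C} = C" "{y\<in>U-C. \<sigma> y \<in> U-C} = U - C"
          using closed C_closed V_closed by auto
        then show ?thesis unfolding T_def by (simp only: sumU)
      qed
      moreover have "E C + E (U - C) \<le> E U"
        using xlnx_superadditive[of "sum n C" "sum n (U - C)"] n
        unfolding E_def by (simp add: sumU[of n] sumU[of "\<lambda>x. xlnx (n x)"] sum_nonneg)
      ultimately show ?thesis by (simp add: distrib_left)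
    qed
  qed
  then show ?case unfolding T_def E_def .
qed

subsection \<open>Independent sets and popular differences\<close>

lemma independent_setD:
  assumes "independent_set G S"
  shows "finite S" "S \<subseteq> carrier G - {\<one>\<^bsub>G\<^esub>}"
    and "(\<Otimes>\<^bsub>G\<^esub>s\<in>S. s [^]\<^bsub>G\<^esub> (k s :: int)) = \<one>\<^bsub>G\<^esub> \<Longrightarrow> t \<in> S \<Longrightarrow> t [^]\<^bsub>G\<^esub> k t = \<one>\<^bsub>G\<^esub>"
  using assms unfolding independent_set_def by blast+

text \<open>For finite \<open>S\<close> this is the subgroup generated by \<open>S\<close>. The
  explicit form turns membership into an exponent function, the object that independence speaks
  about.\<close>

lemma (in comm_group) subgroup_power_products:
  assumes "S \<subseteq> carrier G"
  shows "subgroup (range (\<lambda>k :: 'a \<Rightarrow> int. \<Otimes>s\<in>S. s [^] k s)) G"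
proof (rule subgroupI)
  have cl: "(\<lambda>s. s [^] k s) \<in> S \<rightarrow> carrier G" for k :: "'a \<Rightarrow> int"
    using assms by auto
  show "range (\<lambda>k :: 'a \<Rightarrow> int. \<Otimes>s\<in>S. s [^] k s) \<subseteq> carrier G"
    using finprod_closed[OF cl] by auto
  have mult: "(\<Otimes>s\<in>S. s [^] k s) \<otimes> (\<Otimes>s\<in>S. s [^] l s) = (\<Otimes>s\<in>S. s [^] (k s + l s))"
    for k l :: "'a \<Rightarrow> int"
    using assms
    by (subst finprod_multf[OF cl cl, symmetric], intro finprod_cong') (auto simp: int_pow_mult)
  fix x y
  assume "x \<in> range (\<lambda>k :: 'a \<Rightarrow> int. \<Otimes>s\<in>S. s [^] k s)"
    "y \<in> range (\<lambda>k :: 'a \<Rightarrow> int. \<Otimes>s\<in>S. s [^] k s)"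
  then show "x \<otimes> y \<in> range (\<lambda>k :: 'a \<Rightarrow> int. \<Otimes>s\<in>S. s [^] k s)"
    using mult by auto
next
  fix x
  assume "x \<in> range (\<lambda>k :: 'a \<Rightarrow> int. \<Otimes>s\<in>S. s [^] k s)"
  then obtain k :: "'a \<Rightarrow> int" where x: "x = (\<Otimes>s\<in>S. s [^] k s)" by auto
  have cl: "(\<lambda>s. s [^] k s) \<in> S \<rightarrow> carrier G" for k :: "'a \<Rightarrow> int"
    using assms by auto
  have "(\<Otimes>s\<in>S. s [^] (- k s)) \<otimes> x = (\<Otimes>s\<in>S. s [^] (- k s) \<otimes> s [^] k s)"
    unfolding x by (rule finprod_multf[OF cl cl, symmetric])
  also have "\<dots> = \<one>"
    using assms by (intro finprod_one_eqI) (auto simp: subset_iff int_pow_neg)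
  finally have "inv x = (\<Otimes>s\<in>S. s [^] (- k s))"
    using finprod_closed[OF cl] x by (intro inv_equality) auto
  then show "inv x \<in> range (\<lambda>k :: 'a \<Rightarrow> int. \<Otimes>s\<in>S. s [^] k s)" by auto
qed auto

lemma (in comm_group) mem_power_products:
  assumes "S \<subseteq> carrier G" "finite S" "t \<in> S"
  shows "t \<in> range (\<lambda>k :: 'a \<Rightarrow> int. \<Otimes>s\<in>S. s [^] k s)"
proof -
  have "(\<Otimes>s\<in>S. s [^] (if t = s then 1 else 0 :: int)) = (\<Otimes>s\<in>S. if t = s then s else \<one>)"
    using assms by (intro finprod_cong') (auto simp: subset_iff)
  also have "\<dots> = t" using assms by (intro finprod_singleton) auto
  finally have "(\<Otimes>s\<in>S. s [^] (if t = s then 1 else 0 :: int)) = t" .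
  then show ?thesis by (intro image_eqI[of _ _ "\<lambda>s. if t = s then 1 else 0"]) simp_all
qed

text \<open>Moving the power of \<open>s\<close> to the other side gives a relation on
  \<open>insert s S\<close> with exponent \<open>- j\<close> at \<open>s\<close>, which independence
  makes trivial. It follows that \<open>s\<close> returns a coset to itself only after a multiple of
  its order.\<close>

lemma (in comm_group) independent_set_insert_pow:
  assumes "independent_set G (insert s S)" "s \<notin> S"
    and "s [^] (j::nat) \<in> range (\<lambda>k :: 'a \<Rightarrow> int. \<Otimes>s\<in>S. s [^] k s)"
  shows "s [^] j = \<one>"
proof -
  have fin: "finite S" and S: "S \<subseteq> carrier G" and s: "s \<in> carrier G"
    using independent_setD(1,2)[OF assms(1)] by auto
  obtain k :: "'a \<Rightarrow> int" where k: "s [^] j = (\<Otimes>s\<in>S. s [^] k s)" using assms(3) by auto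
  define l where "l = k(s := - int j)"
  have "(\<Otimes>t\<in>insert s S. t [^] l t) = s [^] l s \<otimes> (\<Otimes>t\<in>S. t [^] l t)"
    using fin S s assms(2) by (intro finprod_insert) auto
  also have "(\<Otimes>t\<in>S. t [^] l t) = s [^] j"
    unfolding k using S assms(2) by (intro finprod_cong') (auto simp: l_def)
  also have "s [^] l s \<otimes> s [^] j = \<one>"
    using s by (simp add: l_def int_pow_neg int_pow_int)
  finally have "s [^] l s = \<one>"
    using independent_setD(3)[OF assms(1)] by blast
  then show ?thesis using s by (simp add: l_def int_pow_neg int_pow_int)
qed

lemma independent_set_subset:
  assumes "comm_group G" "independent_set G T" "S \<subseteq> T"
  shows "independent_set G S"
  unfolding independent_set_def
proof (intro conjI allI impI ballI)
  interpret comm_group G by fact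
  have T: "finite T" "T \<subseteq> carrier G - {\<one>\<^bsub>G\<^esub>}" using independent_setD(1,2)[OF assms(2)] by auto
  then show "finite S" "S \<subseteq> carrier G - {\<one>\<^bsub>G\<^esub>}" using assms(3) by (auto intro: finite_subset)
  fix k :: "'a \<Rightarrow> int" and s
  assume k: "(\<Otimes>\<^bsub>G\<^esub>s\<in>S. s [^]\<^bsub>G\<^esub> k s) = \<one>\<^bsub>G\<^esub>" and s: "s \<in> S"
  define l where "l t = (if t \<in> S then k t else 0)" for t
  have "\<one>\<^bsub>G\<^esub> = (\<Otimes>\<^bsub>G\<^esub>s\<in>T. s [^]\<^bsub>G\<^esub> l s)"
    unfolding k[symmetric]
    using T assms(3) by (intro finprod_mono_neutral_cong_left) (auto simp: l_def)
  from independent_setD(3)[OF assms(2) this[symmetric]]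
  have "s [^]\<^bsub>G\<^esub> l s = \<one>\<^bsub>G\<^esub>" using s assms(3) by blast
  then show "s [^]\<^bsub>G\<^esub> k s = \<one>\<^bsub>G\<^esub>" using s by (simp add: l_def)
qed

section \<open>Counting differences coset by coset\<close>

lemma (in group) diff_count_eq:
  assumes "A \<subseteq> carrier G" "s \<in> carrier G"
  shows "diff_count G A s = card {a \<in> A. s \<otimes> a \<in> A}"
proof -
  have "{(a, a') \<in> A \<times> A. s = a \<otimes> inv a'} = (\<lambda>a. (s \<otimes> a, a)) ` {a \<in> A. s \<otimes> a \<in> A}"
    using assms by (auto simp: image_iff subset_iff m_assoc)
  then show ?thesis
    unfolding diff_count_def by (simp add: card_image inj_on_def)
qed

lemma card_fibres:
  assumes "finite A"
  shows "card {a \<in> A. P a} = (\<Sum>x\<in>f ` A. card {a \<in> A. P a \<and> f a = x})"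
proof -
  have of_bool: "card {a \<in> B. P a} = (\<Sum>a\<in>B. of_bool (P a))" if "finite B" for B
    using that by (simp add: of_bool_def sum.If_cases Int_def conj_commute)
  have "card {a \<in> A. P a} = (\<Sum>x\<in>f ` A. \<Sum>a\<in>{a \<in> A. f a = x}. of_bool (P a))"
    by (simp only: of_bool[OF assms] sum.image_gen[OF assms, of _ f])
  also have "\<dots> = (\<Sum>x\<in>f ` A. card {a \<in> {a \<in> A. f a = x}. P a})"
    using assms by (intro sum.cong[OF refl] of_bool[symmetric]) auto
  also have "\<dots> = (\<Sum>x\<in>f ` A. card {a \<in> A. P a \<and> f a = x})"
    by (intro sum.cong[OF refl] arg_cong[of _ _ card]) auto
  finally show ?thesis .
qed

text \<open>Induction on \<open>S\<close> with \<open>A\<close> varying. The new element is paid for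
  by the entropy of the partition of \<open>A\<close> into cosets of \<open>K\<close>. The earlier
  elements act inside the pieces, where the induction hypothesis bounds them by the sum of
  \<open>xlnx (n C)\<close>, and exactly this sum cancels.\<close>

lemma (in comm_group) sum_diff_count_le:
  assumes "independent_set G S" "A \<subseteq> carrier G" "finite A" "0 \<le> c" "c \<le> 2 * ln 2"
    and "\<And>s. s \<in> S \<Longrightarrow> ord s \<noteq> 0 \<Longrightarrow> cycle_entropy (ord s) c"
  shows "c * (\<Sum>s\<in>S. real (diff_count G A s)) \<le> xlnx (real (card A))"
proof -
  have "finite S" using assms(1) by (rule independent_setD)
  then show ?thesis using assms(1,2,3,6)
  proof (induction S arbitrary: A rule: finite_induct)
    case empty
    have "0 \<le> ln (real (card A))" by (cases "card A = 0") simp_all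
    then show ?case by (simp add: xlnx_def)
  next
    case (insert s S)
    have indep: "independent_set G S"
      using independent_set_subset[OF comm_group_axioms insert.prems(1)] by auto
    have S: "S \<subseteq> carrier G" and s: "s \<in> carrier G"
      using independent_setD(2)[OF insert.prems(1)] by auto
    have A: "a \<in> carrier G" if "a \<in> A" for a using that insert.prems(2) by auto
    define K where "K = range (\<lambda>k :: 'a \<Rightarrow> int. \<Otimes>s\<in>S. s [^] k s)"
    have K: "subgroup K G" unfolding K_def by (rule subgroup_power_products[OF S])
    then have KG: "K \<subseteq> carrier G" by (rule subgroup.subset)
    \<comment> \<open>Only cosets meeting \<open>A\<close> are vertices, so \<open>U\<close> is
      finite, and translation by \<open>s\<close> may leave it: this is where paths arise, even when
      \<open>s\<close> has finite order.\<close>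
    define U where "U = (\<lambda>a. K #> a) ` A"
    define \<sigma> where "\<sigma> C = C #> s" for C
    define F where "F C = {a \<in> A. K #> a = C}" for C
    define n where "n C = real (card (F C))" for C
    have \<sigma>: "\<sigma> (K #> a) = K #> (s \<otimes> a)" if "a \<in> carrier G" for a
      using that s by (simp add: \<sigma>_def coset_mult_assoc[OF KG] m_comm)
    have FA: "F C \<subseteq> A" for C by (auto simp: F_def)
    have finF: "finite (F C)" for C using FA insert.prems(3) by (rule finite_subset)
    have K_coset: "K #> (t \<otimes> a) = K #> a" if "t \<in> S" "a \<in> carrier G" for t a
    proof -
      have "t \<in> K" unfolding K_def using S insert.hyps(1) that(1) by (rule mem_power_products)
      then show ?thesis
        using that S by (metis K KG coset_join2 coset_mult_assoc subsetD)
    qed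
    have funpow: "(\<sigma> ^^ k) (K #> a) = K #> (s [^] k \<otimes> a)" if "a \<in> carrier G" for k a
      using that s by (induction k) (simp_all add: \<sigma> m_ac)
    have inj: "inj_on \<sigma> U"
    proof (rule inj_onI)
      fix C Y assume "C \<in> U" "Y \<in> U" "\<sigma> C = \<sigma> Y"
      then obtain a b where ab: "a \<in> carrier G" "b \<in> carrier G" "C = K #> a" "Y = K #> b"
        using A by (auto simp: U_def)
      then have "C #> s #> inv s = Y #> s #> inv s" using \<open>\<sigma> C = \<sigma> Y\<close> by (simp add: \<sigma>_def)
      then show "C = Y"
        using ab s KG r_coset_subset_G[OF KG] by (simp add: coset_mult_assoc m_assoc)
    qed
    \<comment> \<open>A period \<open>k\<close> puts \<open>s [^] k\<close> into \<open>K\<close>,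
      so \<open>s [^] k = \<one>\<close> by independence. Conversely \<open>ord s\<close> is a
      period, so the minimal one equals \<open>ord s\<close>.\<close>
    have cyc: "cycle_entropy k c"
      if C: "C \<in> U" and "0 < k" and period: "(\<sigma> ^^ k) C = C" and least: "\<And>j. 0 < j \<Longrightarrow> j < k \<Longrightarrow> (\<sigma> ^^ j) C \<noteq> C" for C k
    proof -
      obtain a where a: "a \<in> carrier G" "C = K #> a" using C A by (auto simp: U_def)
      have "K #> (s [^] k \<otimes> a) = K #> a" using period a by (simp add: funpow)
      then have "K #> (s [^] k \<otimes> a) #> inv a = K #> a #> inv a" by (rule arg_cong)
      then have "K #> (s [^] k) = K" using a s KG by (simp add: coset_mult_assoc m_assoc)
      then have "s [^] k \<in> K" by (rule coset_join1[OF _ nat_pow_closed[OF s] K])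
      then have "s [^] k = \<one>"
        unfolding K_def by (rule independent_set_insert_pow[OF insert.prems(1) insert.hyps(2)])
      then have dvd: "ord s dvd k" using s by (simp add: pow_eq_id)
      then have pos: "0 < ord s" using \<open>0 < k\<close> by (auto intro: Nat.gr0I)
      have "(\<sigma> ^^ ord s) C = C" using a s by (simp add: funpow)
      then have "ord s = k" using least[of "ord s"] pos dvd_imp_le[OF dvd \<open>0 < k\<close>] by fastforce
      then show ?thesis using insert.prems(4)[of s] pos by auto
    qed
    have cardA: "real (card A) = sum n U"
      using card_fibres[OF insert.prems(3), of "\<lambda>_. True" "\<lambda>a. K #> a"]
      by (simp add: U_def n_def F_def)
    have count: "real (diff_count G A t) = (\<Sum>C\<in>U. real (card {a \<in> A. t \<otimes> a \<in> A \<and> K #> a = C}))"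
      if "t \<in> carrier G" for t
      using card_fibres[OF insert.prems(3), of "\<lambda>a. t \<otimes> a \<in> A" "\<lambda>a. K #> a"]
        diff_count_eq[OF insert.prems(2) that]
      by (simp add: U_def)
    have "c * real (diff_count G A s) \<le> c * (\<Sum>C\<in>{C\<in>U. \<sigma> C \<in> U}. min (n C) (n (\<sigma> C)))"
    proof (rule mult_left_mono)
      \<comment> \<open>An element counted here lies in the piece \<open>F C\<close> and its
        translate in \<open>F (\<sigma> C)\<close>. Translation is injective, so both sizes bound
        the count.\<close>
      have "real (card {a \<in> A. s \<otimes> a \<in> A \<and> K #> a = C}) \<le> (if \<sigma> C \<in> U then min (n C) (n (\<sigma> C)) else 0)"
        if "C \<in> U" for C
      proof (cases "\<sigma> C \<in> U")
        case True
        have "card {a \<in> A. s \<otimes> a \<in> A \<and> K #> a = C} \<le> card (F C)"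
          by (intro card_mono finF) (auto simp: F_def)
        moreover have "card {a \<in> A. s \<otimes> a \<in> A \<and> K #> a = C} \<le> card (F (\<sigma> C))"
          using s A by (intro card_inj_on_le[of "\<lambda>a. s \<otimes> a"] finF) (auto simp: inj_on_def F_def \<sigma>)
        ultimately show ?thesis using True by (simp add: n_def)
      next
        case False
        then have none: "{a \<in> A. s \<otimes> a \<in> A \<and> K #> a = C} = {}" using A by (auto simp: U_def \<sigma>)
        show ?thesis unfolding none using False by simp
      qed
      then have "real (diff_count G A s) \<le> (\<Sum>C\<in>U. if \<sigma> C \<in> U then min (n C) (n (\<sigma> C)) else 0)"
        unfolding count[OF s] by (rule sum_mono)
      also have "\<dots> = (\<Sum>C\<in>{C\<in>U. \<sigma> C \<in> U}. min (n C) (n (\<sigma> C)))"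
        using insert.prems(3) by (simp add: U_def sum.inter_filter)
      finally show "real (diff_count G A s) \<le> \<dots>" .
    qed (rule assms(4))
    also have "\<dots> \<le> xlnx (sum n U) - (\<Sum>C\<in>U. xlnx (n C))"
      using insert.prems(3) inj assms(4,5) cyc
      by (intro orbit_entropy) (auto simp: U_def n_def)
    finally have s_le: "c * real (diff_count G A s) \<le> xlnx (card A) - (\<Sum>C\<in>U. xlnx (n C))"
      by (simp only: cardA)
    \<comment> \<open>Each \<open>t\<close> in \<open>S\<close> lies in \<open>K\<close> and fixes
      every coset, so no difference \<open>t\<close> is realised across two pieces.\<close>
    have "(\<Sum>t\<in>S. real (diff_count G A t)) = (\<Sum>t\<in>S. \<Sum>C\<in>U. real (diff_count G (F C) t))"
    proof (rule sum.cong[OF refl])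
      fix t assume t: "t \<in> S"
      have "{a \<in> A. t \<otimes> a \<in> A \<and> K #> a = C} = {a \<in> F C. t \<otimes> a \<in> F C}" for C
        using K_coset[OF t] A by (auto simp: F_def)
      moreover have "diff_count G (F C) t = card {a \<in> F C. t \<otimes> a \<in> F C}" for C
        using FA[of C] insert.prems(2) S t by (intro diff_count_eq) auto
      ultimately show "real (diff_count G A t) = (\<Sum>C\<in>U. real (diff_count G (F C) t))"
        using count[of t] S t by auto
    qed
    also have "\<dots> = (\<Sum>C\<in>U. \<Sum>t\<in>S. real (diff_count G (F C) t))" by (rule sum.swap)
    finally have "c * (\<Sum>t\<in>S. real (diff_count G A t))
        = (\<Sum>C\<in>U. c * (\<Sum>t\<in>S. real (diff_count G (F C) t)))"
      by (simp add: sum_distrib_left)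
    also have "\<dots> \<le> (\<Sum>C\<in>U. xlnx (n C))"
      unfolding n_def using FA insert.prems(2,4)
      by (intro sum_mono insert.IH indep finF) (auto intro: order_trans)
    finally show ?case
      using s_le insert.hyps by (simp add: distrib_left)
  qed
qed

section \<open>From sums of difference counts to the dimension\<close>

lemma finite_popular_differences:
  assumes "finite A" "A \<noteq> {}" "0 < \<gamma>"
  shows "finite (popular_differences G \<gamma> A)"
proof (rule finite_subset)
  show "popular_differences G \<gamma> A \<subseteq> (\<lambda>(a, a'). a \<otimes>\<^bsub>G\<^esub> inv\<^bsub>G\<^esub> a') ` (A \<times> A)"
  proof
    fix g assume "g \<in> popular_differences G \<gamma> A"
    moreover have "0 < \<gamma> * real (card A)" using assms by (simp add: card_gt_0_iff)
    ultimately have "diff_count G A g \<noteq> 0" by (auto simp: popular_differences_def)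
    then have "{(a, a') \<in> A \<times> A. g = a \<otimes>\<^bsub>G\<^esub> inv\<^bsub>G\<^esub> a'} \<noteq> {}"
      unfolding diff_count_def by (rule contrapos_nn) (simp only: card.empty)
    then show "g \<in> (\<lambda>(a, a'). a \<otimes>\<^bsub>G\<^esub> inv\<^bsub>G\<^esub> a') ` (A \<times> A)" by auto
  qed
qed (use assms in auto)

text \<open>Finiteness of \<open>P\<close> and independence of the empty set make the maximum in
  \<open>dim_I\<close> genuine.\<close>

lemma dim_I_attained:
  assumes "finite P"
  obtains S where "S \<subseteq> P" "independent_set G S" "card S = dim_I G P"
proof -
  have "{card S |S. S \<subseteq> P \<and> independent_set G S} \<subseteq> card ` Pow P" by auto
  then have "finite {card S |S. S \<subseteq> P \<and> independent_set G S}"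
    using assms by (auto intro: finite_subset)
  moreover have "independent_set G {}" by (simp add: independent_set_def)
  then have "{card S |S. S \<subseteq> P \<and> independent_set G S} \<noteq> {}" by blast
  ultimately have "dim_I G P \<in> {card S |S. S \<subseteq> P \<and> independent_set G S}"
    unfolding dim_I_def by (rule Max_in)
  then show ?thesis using that by auto
qed

text \<open>Common source of both bounds, with the constant \<open>c\<close> left open: popularity
  bounds the sum of the counts below by \<open>card S * (\<gamma> * card A)\<close>, and one factor
  \<open>card A\<close> cancels.\<close>

lemma (in comm_group) dim_I_popular_differences_le:
  assumes "A \<subseteq> carrier G" "finite A" "A \<noteq> {}" "0 < \<gamma>" "0 < c" "c \<le> 2 * ln 2"
    and cycle: "\<And>g. g \<in> carrier G - {\<one>} \<Longrightarrow> ord g \<noteq> 0 \<Longrightarrow> cycle_entropy (ord g) c"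
  shows "real (dim_I G (popular_differences G \<gamma> A)) \<le> inverse \<gamma> * (ln (card A) / c)"
proof -
  obtain S where S: "S \<subseteq> popular_differences G \<gamma> A" "independent_set G S"
    "card S = dim_I G (popular_differences G \<gamma> A)"
    using dim_I_attained finite_popular_differences[OF assms(2,3,4)] by blast
  have pos: "0 < real (card A)" using assms(2,3) by (simp add: card_gt_0_iff)
  have "real (card S) * (\<gamma> * card A) \<le> (\<Sum>s\<in>S. real (diff_count G A s))"
    using S(1) by (intro sum_bounded_below) (auto simp: popular_differences_def)
  then have "c * (real (card S) * (\<gamma> * card A)) \<le> c * (\<Sum>s\<in>S. real (diff_count G A s))"
    using assms(5) by simp
  also have "\<dots> \<le> xlnx (real (card A))"
    using S(2) assms(1,2,5,6) independent_setD(2)[OF S(2)]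
    by (intro sum_diff_count_le cycle) auto
  finally have "card A * (c * \<gamma> * real (card S)) \<le> card A * ln (card A)"
    by (simp add: xlnx_def mult_ac)
  then have "c * \<gamma> * real (card S) \<le> ln (card A)" using pos by (simp only: mult_le_cancel_left_pos)
  then show ?thesis using assms(4,5) S(3) by (simp add: field_simps)
qed

lemma (in group) smallest_order_le:
  assumes "g \<in> carrier G - {\<one>}" "ord g \<noteq> 0"
  shows "0 < smallest_order G" "smallest_order G \<le> ord g"
proof -
  let ?Q = "\<lambda>n. n \<noteq> 0 \<and> (\<exists>g \<in> carrier G - {\<one>}. ord g = n)"
  have "\<exists>g \<in> carrier G - {\<one>}. ord g \<noteq> 0" using assms by blast
  then have least: "smallest_order G = (LEAST n. ?Q n)"
    unfolding smallest_order_def by (rule if_P)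
  have "?Q (ord g)" using assms by blast
  then show "0 < smallest_order G" "smallest_order G \<le> ord g"
    unfolding least by (rule LeastI2, simp, rule Least_le)
qed

lemma (in group) smallest_order_attained:
  assumes "smallest_order G \<noteq> 0"
  obtains g where "g \<in> carrier G - {\<one>}" "ord g = smallest_order G"
proof -
  let ?Q = "\<lambda>n. n \<noteq> 0 \<and> (\<exists>g \<in> carrier G - {\<one>}. ord g = n)"
  have ex: "\<exists>g \<in> carrier G - {\<one>}. ord g \<noteq> 0"
    using assms unfolding smallest_order_def by metis
  then have least: "smallest_order G = (LEAST n. ?Q n)"
    unfolding smallest_order_def by (rule if_P)
  from ex have "\<exists>n. ?Q n" by blast
  then have "?Q (smallest_order G)" unfolding least by (rule LeastI_ex)
  then show ?thesis using that by blast
qed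

theorem theorem1p8:
  fixes G :: "('a, 'b) monoid_scheme" and A :: "'a set" and \<gamma> :: real
  assumes "comm_group G"
    and "A \<subseteq> carrier G" and "finite A" and "A \<noteq> {}"
    and "0 < \<gamma>" and "\<gamma> \<le> 1"
  shows "real (dim_I G (popular_differences G \<gamma> A))
           \<le> inverse (2 * (1 - 1 / real (smallest_order G))) * inverse \<gamma> * log 2 (real (card A))
       \<and> (group_exponent G = 3 \<longrightarrow>
            real (dim_I G (popular_differences G \<gamma> A)) \<le> inverse \<gamma> * log 3 (real (card A)))"
proof
  interpret comm_group G by fact
  define p where "p = smallest_order G"
  have p_le: "0 < p" "p \<le> ord g" if "g \<in> carrier G - {\<one>\<^bsub>G\<^esub>}" "ord g \<noteq> 0" for g
    using smallest_order_le[OF that] by (simp_all add: p_def)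
  have p_ne_1: "p \<noteq> 1"
  proof
    assume "p = 1"
    then obtain g where "g \<in> carrier G - {\<one>\<^bsub>G\<^esub>}" "ord g = 1"
      using smallest_order_attained by (auto simp: p_def)
    then show False using ord_eq_1[of g] by auto
  qed
  define c where "c = 2 * (1 - 1 / real p) * ln 2"
  \<comment> \<open>For \<open>p = 0\<close> the convention \<open>1 / 0 = 0\<close> gives the
    factor 1, so \<open>c\<close> is the path constant 2 ln 2.\<close>
  have "0 < 1 - 1 / real p" using p_ne_1 by (cases "p = 0") auto
  moreover have "1 - 1 / real p \<le> 1" by simp
  ultimately have c: "0 < c" "c \<le> 2 * ln 2" by (auto simp: c_def)
  have "cycle_entropy (ord g) c" if "g \<in> carrier G - {\<one>\<^bsub>G\<^esub>}" "ord g \<noteq> 0" for g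
  proof (rule cycle_entropy_mono)
    show "cycle_entropy (ord g) (2 * (1 - 1 / real (ord g)) * ln 2)"
      using that by (intro cycle_entropy_general) auto
    \<comment> \<open>The cycle constant grows with the length, so the smallest order is the worst
      case.\<close>
    show "c \<le> 2 * (1 - 1 / real (ord g)) * ln 2"
      using p_le[OF that] by (auto simp: c_def intro!: divide_left_mono)
  qed
  then have "real (dim_I G (popular_differences G \<gamma> A)) \<le> inverse \<gamma> * (ln (card A) / c)"
    using assms c by (intro dim_I_popular_differences_le) auto
  also have "\<dots> = inverse (2 * (1 - 1 / real p)) * inverse \<gamma> * log 2 (real (card A))"
    by (simp add: c_def log_def divide_inverse mult_ac)
  finally show "real (dim_I G (popular_differences G \<gamma> A))
      \<le> inverse (2 * (1 - 1 / real (smallest_order G))) * inverse \<gamma> * log 2 (real (card A))"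
    by (simp only: p_def)
  show "group_exponent G = 3 \<longrightarrow>
      real (dim_I G (popular_differences G \<gamma> A)) \<le> inverse \<gamma> * log 3 (real (card A))"
  proof
    assume exp3: "group_exponent G = 3"
    let ?E = "\<lambda>n::nat. n > 0 \<and> (\<forall>g \<in> carrier G. g [^]\<^bsub>G\<^esub> n = \<one>\<^bsub>G\<^esub>)"
    \<comment> \<open>The value 3 differs from the default 0, so an annihilating exponent
      exists.\<close>
    have ex: "\<exists>n. ?E n" using exp3 unfolding group_exponent_def by (metis zero_neq_numeral)
    then have "group_exponent G = (LEAST n. ?E n)" unfolding group_exponent_def by (rule if_P)
    with LeastI_ex[OF ex] exp3 have three: "g [^]\<^bsub>G\<^esub> (3::nat) = \<one>\<^bsub>G\<^esub>" if "g \<in> carrier G" for g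
      using that by simp
    have "cycle_entropy (ord g) (ln 3)" if "g \<in> carrier G - {\<one>\<^bsub>G\<^esub>}" for g
    proof -
      have "ord g dvd 3" using three[of g] that by (simp add: pow_eq_id)
      moreover from this have "ord g \<in> {0, 1, 2, 3}" using dvd_imp_le[of "ord g" 3] by auto
      moreover have "ord g \<noteq> 1" using that ord_eq_1[of g] by auto
      ultimately have "ord g = 3" by auto
      then show ?thesis using cycle_entropy_3 by simp
    qed
    \<comment> \<open>Orbits that leave the support are paths, so the constant must not exceed the
      path constant either.\<close>
    moreover have "ln 3 \<le> 2 * ln (2 :: real)"
    proof -
      have "ln 3 \<le> ln (2 ^ 2 :: real)" by (subst ln_le_cancel_iff) auto
      then show ?thesis by (simp only: ln_realpow)
    qed
    ultimately have "real (dim_I G (popular_differences G \<gamma> A)) \<le> inverse \<gamma> * (ln (card A) / ln 3)"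
      using assms by (intro dim_I_popular_differences_le) auto
    then show "real (dim_I G (popular_differences G \<gamma> A)) \<le> inverse \<gamma> * log 3 (real (card A))"
      by (simp add: log_def)
  qed
qed

end
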